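(* Let $F\colon \mathbb{R}^n\rightrightarrows \mathbb{R}^m$ be a set-valued mapping with closed graph, and let $\overline{y} \in J(F)$. Let $$\mathscr{F} := \Big\{ w : \exists\, (x_k,y_k)\in\mathrm{gph}\,F,\ \|x_k\|\to\infty,\ y_k\to\overline{y},\ \exists\, w_k\in\partial d_F(x_k,y_k),\ w_k\to w\Big\},$$ $$\mathscr{F}^\infty := \Big\{ w : \exists\, (x_k,y_k)\in\mathrm{gph}\,F,\ \|x_k\|\to\infty,\ y_k\to\overline{y},\ \exists\, r_k\searrow 0,\ \exists\, w_k\in\partial d_F(x_k,y_k),\ r_kw_k\to w\Big\}.$$ The following conditions are equivalent: (i) $D^*F(\infty, \overline{y})(0)=\{0\}$. (ii) There exist constants $R > 0$, $\ell > 0$ and an open neighborhood $V$ of $\overline{y}$ in $\mathbb{R}^m$ such that the set $F^{-1}(V) \setminus \mathbb{B}_R$ is open and one has $$F(x) \cap V \subset F(x') + \ell\|x - x'\| \mathbb{B} \quad \text{for all } x, x' \in F^{-1}(V) \setminus \mathbb{B}_R.$$ (iii) There exist constants $R > 0$, $\ell > 0$ and a neighborhood $V$ of $\overline{y}$ in $\mathbb{R}^m$ such that the function $d_F$ is Lipschitz continuous with modulus $\ell$ on some neighborhood of each point of $\mathrm{gph}\, F \cap \big( (\mathbb{R}^n \setminus \mathbb{B}_R) \times V \big)$. (iv) $\mathscr{F}^\infty = \{0\}$. When these equivalent conditions hold, one has moreover that $\|u\| \leq \ell$ whenever $u \in \mathscr{F}$, where $\ell$ is a constant as in (iii).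
   Context: All spaces $\mathbb{R}^n$ (including $\mathbb{R}^n\times\mathbb{R}^m$) carry the Euclidean norm; $\mathbb{B}_r$ is the closed ball of radius $r$ centered at the origin and $\mathbb{B}=\mathbb{B}_1$. For $F\colon \mathbb{R}^n \rightrightarrows \mathbb{R}^m$: $\mathrm{gph}\,F := \{(x,y) : y\in F(x)\}$ and $F^{-1}(V) := \{x : F(x)\cap V\neq\emptyset\}$. $r_k\searrow0$ means $r_k>0$ and $r_k\to0$. The distance function of $F$ is $d_F\colon\mathbb{R}^n\times\mathbb{R}^m\to\mathbb{R}\cup\{+\infty\}$, $d_F(x,y):=\inf\{\|y-v\| : v\in F(x)\}$, with $\inf\emptyset=+\infty$. ("Lipschitz continuous on a set" includes being finite there.) Jelonek set: $J(F)$ is the set of $y\in\mathbb{R}^m$ for which there exist $(x_k,y_k)\in \mathrm{gph}\,F$ with $\|x_k\|\to\infty$ and $y_k\to y$. Normal cones: for $\Omega\subset\mathbb{R}^N$ and $z\in\Omega$, the regular normal cone $\widehat{N}_\Omega(z)$ is the set of $\xi$ with $\langle \xi, z'-z\rangle\le o(\|z'-z\|)$ as $z'\to z$, $z'\in\Omega$; the limiting normal cone $N_\Omega(z)$ is the set of $\xi$ for which there exist $z_k\in\Omega$, $z_k\to z$, and $\xi_k\in\widehat{N}_\Omega(z_k)$ with $\xi_k\to\xi$. Limiting subdifferential: for $f\colon\mathbb{R}^N\to\mathbb{R}\cup\{+\infty\}$ and $z$ with $f(z)<\infty$, $\partial f(z):=\{u\in\mathbb{R}^N : (u,-1)\in N_{\mathrm{epi}\,f}(z,f(z))\}$,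 where $\mathrm{epi}\,f:=\{(z,r)\in\mathbb{R}^N\times\mathbb{R} : f(z)\le r\}$. Normal cone at infinity: for $\Omega\subset\mathbb{R}^n\times\mathbb{R}^m$ and $\overline{y}\in\mathbb{R}^m$, $N_\Omega(\infty,\overline{y})$ is the set of all $\xi$ for which there exist $(x_k,y_k)\in\Omega$ with $\|x_k\|\to\infty$, $y_k\to\overline{y}$, and $\xi_k\in\widehat{N}_\Omega(x_k,y_k)$ with $\xi_k\to\xi$. Coderivative at infinity: for $\overline{y}\in J(F)$, $D^*F(\infty,\overline{y})(v) := \{u\in\mathbb{R}^n : (u,-v)\in N_{\mathrm{gph}\,F}(\infty,\overline{y})\}$, $v\in\mathbb{R}^m$. *)

theory Defs
  imports "HOL-Analysis.Analysis" "HOL-Library.Set_Algebras"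
begin

text \<open>A set-valued mapping is a function into sets. The product type carries the Euclidean norm.\<close>

definition gph :: "('a \<Rightarrow> 'b set) \<Rightarrow> ('a \<times> 'b) set" where
  "gph F = {(x, y). y \<in> F x}"

definition inv_map :: "('a \<Rightarrow> 'b set) \<Rightarrow> 'b set \<Rightarrow> 'a set" where
  "inv_map F V = {x. F x \<inter> V \<noteq> {}}"

text \<open>In \<^typ>\<open>ereal\<close> the infimum over the empty set is \<open>\<infinity>\<close>, as required when \<open>F x = {}\<close>.\<close>

definition dist_map :: "('a \<Rightarrow> 'b::real_normed_vector set) \<Rightarrow> 'a \<times> 'b \<Rightarrow> ereal" where
  "dist_map F = (\<lambda>(x, y). INF v\<in>F x. ereal (norm (y - v)))"

definition jelonek_set ::
    "('a::real_normed_vector \<Rightarrow> 'b::topological_space set) \<Rightarrow> 'b set" where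
  "jelonek_set F = {y. \<exists>xs ys. (\<forall>k::nat. (xs k, ys k) \<in> gph F) \<and>
     filterlim (\<lambda>k. norm (xs k)) at_top sequentially \<and> ys \<longlonglongrightarrow> y}"

text \<open>The bound \<open>\<xi> \<bullet> (z' - z) \<le> o(norm (z' - z))\<close> is one-sided, hence spelled out with \<open>\<epsilon>\<close>.
  Both cones are only meaningful at points \<open>z\<close> of \<open>\<Omega>\<close>.\<close>

definition regular_normal_cone :: "'a::real_inner set \<Rightarrow> 'a \<Rightarrow> 'a set" where
  "regular_normal_cone \<Omega> z = {\<xi>. \<forall>\<epsilon>>0. \<forall>\<^sub>F z' in at z within \<Omega>. \<xi> \<bullet> (z' - z) \<le> \<epsilon> * norm (z' - z)}"

definition limiting_normal_cone :: "'a::real_inner set \<Rightarrow> 'a \<Rightarrow> 'a set" where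
  "limiting_normal_cone \<Omega> z = {\<xi>. \<exists>zs \<xi>s. (\<forall>k::nat. zs k \<in> \<Omega>) \<and> zs \<longlonglongrightarrow> z \<and>
     (\<forall>k. \<xi>s k \<in> regular_normal_cone \<Omega> (zs k)) \<and> \<xi>s \<longlonglongrightarrow> \<xi>}"

definition epi :: "('a \<Rightarrow> ereal) \<Rightarrow> ('a \<times> real) set" where
  "epi f = {(z, r). f z \<le> ereal r}"

text \<open>Empty where \<open>f\<close> is not finite.\<close>

definition limiting_subdifferential :: "('a::real_inner \<Rightarrow> ereal) \<Rightarrow> 'a \<Rightarrow> 'a set" where
  "limiting_subdifferential f z =
     {u. \<bar>f z\<bar> \<noteq> \<infinity> \<and> (u, -1) \<in> limiting_normal_cone (epi f) (z, real_of_ereal (f z))}"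

definition normal_cone_at_infinity ::
    "('a::real_inner \<times> 'b::real_inner) set \<Rightarrow> 'b \<Rightarrow> ('a \<times> 'b) set" where
  "normal_cone_at_infinity \<Omega> y = {\<xi>. \<exists>xs ys \<xi>s. (\<forall>k::nat. (xs k, ys k) \<in> \<Omega>) \<and>
     filterlim (\<lambda>k. norm (xs k)) at_top sequentially \<and> ys \<longlonglongrightarrow> y \<and>
     (\<forall>k. \<xi>s k \<in> regular_normal_cone \<Omega> (xs k, ys k)) \<and> \<xi>s \<longlonglongrightarrow> \<xi>}"

definition coderivative_at_infinity ::
    "('a::real_inner \<Rightarrow> 'b::real_inner set) \<Rightarrow> 'b \<Rightarrow> 'b \<Rightarrow> 'a set" where
  "coderivative_at_infinity F y v = {u. (u, - v) \<in> normal_cone_at_infinity (gph F) y}"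

text \<open>The sets \<open>\<F>\<close> and \<open>\<F>\<^sup>\<infinity>\<close> of limits of (scaled) subgradients of the distance function.\<close>

definition dist_subgradients_at_infinity ::
    "('a::real_inner \<Rightarrow> 'b::real_inner set) \<Rightarrow> 'b \<Rightarrow> ('a \<times> 'b) set" where
  "dist_subgradients_at_infinity F y = {w. \<exists>xs ys ws. (\<forall>k::nat. (xs k, ys k) \<in> gph F) \<and>
     filterlim (\<lambda>k. norm (xs k)) at_top sequentially \<and> ys \<longlonglongrightarrow> y \<and>
     (\<forall>k. ws k \<in> limiting_subdifferential (dist_map F) (xs k, ys k)) \<and> ws \<longlonglongrightarrow> w}"

definition dist_horizon_subgradients_at_infinity ::
    "('a::real_inner \<Rightarrow> 'b::real_inner set) \<Rightarrow> 'b \<Rightarrow> ('a \<times> 'b) set" where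
  "dist_horizon_subgradients_at_infinity F y =
     {w. \<exists>xs ys rs ws. (\<forall>k::nat. (xs k, ys k) \<in> gph F) \<and>
     filterlim (\<lambda>k. norm (xs k)) at_top sequentially \<and> ys \<longlonglongrightarrow> y \<and>
     (\<forall>k. rs k > 0) \<and> rs \<longlonglongrightarrow> (0::real) \<and>
     (\<forall>k. ws k \<in> limiting_subdifferential (dist_map F) (xs k, ys k)) \<and>
     (\<lambda>k. rs k *\<^sub>R ws k) \<longlonglongrightarrow> w}"

definition finite_lipschitz_on :: "real \<Rightarrow> 'a::metric_space set \<Rightarrow> ('a \<Rightarrow> ereal) \<Rightarrow> bool" where
  "finite_lipschitz_on l U f \<longleftrightarrow>
     (\<forall>z\<in>U. \<bar>f z\<bar> \<noteq> \<infinity>) \<and> l-lipschitz_on U (\<lambda>z. real_of_ereal (f z))"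

definition dist_locally_lipschitz ::
    "('a::real_normed_vector \<Rightarrow> 'b::real_normed_vector set) \<Rightarrow> real \<Rightarrow> real \<Rightarrow> 'b set \<Rightarrow> bool" where
  "dist_locally_lipschitz F R l V \<longleftrightarrow>
     (\<forall>p \<in> gph F \<inter> ((- cball 0 R) \<times> V). \<exists>U. p \<in> interior U \<and> finite_lipschitz_on l U (dist_map F))"

end

theory Submission imports Defs
begin

text \<open>
  Everything turns on the inequality \<open>norm u \<le> l * norm v\<close> for regular normals \<open>(u, - v)\<close> to the
  graph at points \<open>(x, y)\<close> with \<open>x\<close> far out and \<open>y\<close> near \<open>ybar\<close>, and on its geometric counterpart:
  from such a point the graph can be followed to any nearby argument \<open>x'\<close> by moving \<open>y\<close> at most
  \<open>l * norm (x' - x)\<close>.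

  Triviality of the coderivative at infinity yields the inequality by normalising a sequence of
  violating normals and extracting a limit (\<open>normal_bound_near_infinity\<close>).  To follow the graph
  from \<open>(x0, y0)\<close> to \<open>x'\<close>, minimise \<open>norm (x - x') + a * (norm (y - y0))\<^sup>2\<close> over the graph.  At a
  minimiser with \<open>x \<noteq> x'\<close> the negative gradient is a regular normal with \<open>norm u = 1\<close>, while a
  suitable \<open>a\<close> makes \<open>v\<close> too small for the inequality; hence the minimiser lies over \<open>x'\<close>
  (\<open>selection_from_normal_bound\<close>).  The step length allowed here is uniform near infinity
  (\<open>uniform_selection_near_infinity\<close>), and from this the Lipschitz-like property (ii) and the local
  Lipschitz continuity (iii) of the distance function follow by the triangle inequality.

  Conversely, (ii) and (iii) each allow the graph to be followed locally, with a common constant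
  \<open>l\<close>.  Testing a normal \<open>(u, w)\<close> along the path over the direction \<open>u\<close> returns the inequality
  (\<open>regular_normal_bound\<close>), so a normal limit with vanishing second component is \<open>0\<close>.  The same test
  on the epigraph bounds subgradients of an \<open>l\<close>-Lipschitz function by \<open>l\<close>, which gives (iv) and the
  final bound.

  To come back from (iv), a regular graph normal \<open>(u, w)\<close> with \<open>norm w < 1\<close> is a subgradient of the
  distance function (\<open>regular_normal_subgradient_dist_map\<close>).  If normals \<open>(u\<^sub>k, w\<^sub>k)\<close> tend to
  \<open>(u, 0)\<close>, they can be divided by some \<open>r\<^sub>k\<close> tending to \<open>0\<close> with \<open>norm w\<^sub>k < r\<^sub>k\<close>, so \<open>(u, 0)\<close> is a
  horizon subgradient at infinity.
\<close>

section \<open>Regular normals\<close>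

lemma regular_normal_cone_iff:
  "\<xi> \<in> regular_normal_cone \<Omega> z \<longleftrightarrow>
     (\<forall>\<epsilon>>0. \<exists>\<delta>>0. \<forall>z'\<in>\<Omega>. norm (z' - z) < \<delta> \<longrightarrow> \<xi> \<bullet> (z' - z) \<le> \<epsilon> * norm (z' - z))"
proof -
  have "(z' \<noteq> z \<and> dist z' z < \<delta> \<longrightarrow> \<xi> \<bullet> (z' - z) \<le> \<epsilon> * norm (z' - z)) \<longleftrightarrow>
      (norm (z' - z) < \<delta> \<longrightarrow> \<xi> \<bullet> (z' - z) \<le> \<epsilon> * norm (z' - z))" for z' \<delta> \<epsilon>
    by (cases "z' = z") (auto simp: dist_norm)
  then show ?thesis
    by (simp only: regular_normal_cone_def eventually_at mem_Collect_eq)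
qed

lemma zero_in_regular_normal_cone: "0 \<in> regular_normal_cone \<Omega> z"
  by (auto simp: regular_normal_cone_iff intro: exI[of _ 1])

lemma regular_normal_cone_scaleR:
  assumes "\<xi> \<in> regular_normal_cone \<Omega> z" "0 < c"
  shows "c *\<^sub>R \<xi> \<in> regular_normal_cone \<Omega> z"
  unfolding regular_normal_cone_iff
proof (intro allI impI)
  fix \<epsilon> :: real assume "\<epsilon> > 0"
  then have "\<epsilon> / c > 0" using assms by simp
  then obtain \<delta> where "\<delta> > 0"
    and "\<forall>z'\<in>\<Omega>. norm (z' - z) < \<delta> \<longrightarrow> \<xi> \<bullet> (z' - z) \<le> \<epsilon> / c * norm (z' - z)"
    using assms(1) unfolding regular_normal_cone_iff by blast
  with \<open>0 < c\<close> show "\<exists>\<delta>>0. \<forall>z'\<in>\<Omega>. norm (z' - z) < \<delta> \<longrightarrow>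
      (c *\<^sub>R \<xi>) \<bullet> (z' - z) \<le> \<epsilon> * norm (z' - z)"
    by (intro exI[of _ \<delta>]) (auto simp: field_simps)
qed

lemma regular_subset_limiting_normal_cone:
  assumes "z \<in> \<Omega>"
  shows "regular_normal_cone \<Omega> z \<subseteq> limiting_normal_cone \<Omega> z"
proof
  fix \<xi> assume "\<xi> \<in> regular_normal_cone \<Omega> z"
  with assms show "\<xi> \<in> limiting_normal_cone \<Omega> z"
    unfolding limiting_normal_cone_def
    by (intro CollectI exI[of _ "\<lambda>_. z"] exI[of _ "\<lambda>_. \<xi>"]) auto
qed

text \<open>Fermat's rule on a set; this is what turns the minimisation argument into a statement about
  normals.\<close>

lemma minimiser_regular_normal:
  fixes f :: "'a::real_inner \<Rightarrow> real"
  assumes der: "(f has_derivative (\<lambda>h. g \<bullet> h)) (at z)"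
    and min: "\<And>z'. z' \<in> \<Omega> \<Longrightarrow> f z \<le> f z'"
  shows "- g \<in> regular_normal_cone \<Omega> z"
  unfolding regular_normal_cone_iff
proof (intro allI impI)
  fix \<epsilon> :: real assume "\<epsilon> > 0"
  then obtain \<delta> where "\<delta> > 0"
    and \<delta>: "\<And>z'. norm (z' - z) < \<delta> \<Longrightarrow> norm (f z' - f z - g \<bullet> (z' - z)) \<le> \<epsilon> * norm (z' - z)"
    using der unfolding has_derivative_at_alt by blast
  have "(- g) \<bullet> (z' - z) \<le> \<epsilon> * norm (z' - z)" if "z' \<in> \<Omega>" "norm (z' - z) < \<delta>" for z'
    using \<delta>[OF that(2)] min[OF that(1)] by simp
  with \<open>\<delta> > 0\<close> show "\<exists>\<delta>>0. \<forall>z'\<in>\<Omega>. norm (z' - z) < \<delta> \<longrightarrow> - g \<bullet> (z' - z) \<le> \<epsilon> * norm (z' - z)"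
    by blast
qed

text \<open>If the set can be followed from \<open>(a, b)\<close> in every direction of the first factor at speed \<open>l\<close>
  in the second, then testing a normal \<open>(u, w)\<close> along \<open>u\<close> itself bounds \<open>u\<close> by \<open>w\<close>.  Graphs of
  Lipschitz-like mappings and epigraphs of Lipschitz functions are both of this kind.\<close>

lemma regular_normal_bound:
  fixes a u :: "'a::real_inner" and b w :: "'b::real_inner"
  assumes normal: "(u, w) \<in> regular_normal_cone \<Omega> (a, b)"
    and "0 \<le> l" "0 < \<delta>"
    and follow: "\<And>a'. norm (a' - a) < \<delta> \<Longrightarrow> \<exists>b'. (a', b') \<in> \<Omega> \<and> norm (b' - b) \<le> l * norm (a' - a)"
  shows "norm u \<le> l * norm w"
proof (cases "u = 0")
  case False
  then have u: "norm u > 0" by simp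
  show ?thesis
  proof (rule field_le_epsilon)
    fix e :: real assume "e > 0"
    define \<epsilon> where "\<epsilon> = e / (1 + l)"
    have "\<epsilon> > 0" using \<open>e > 0\<close> \<open>0 \<le> l\<close> by (simp add: \<epsilon>_def)
    then obtain \<eta> where "\<eta> > 0" and \<eta>: "\<forall>z'\<in>\<Omega>. norm (z' - (a, b)) < \<eta> \<longrightarrow>
        (u, w) \<bullet> (z' - (a, b)) \<le> \<epsilon> * norm (z' - (a, b))"
      using normal unfolding regular_normal_cone_iff by blast
    have "min \<delta> (\<eta> / (1 + l)) > 0" using \<open>\<delta> > 0\<close> \<open>\<eta> > 0\<close> \<open>0 \<le> l\<close> by simp
    then obtain s where "0 < s" "s < min \<delta> (\<eta> / (1 + l))"
      using dense[of 0 "min \<delta> (\<eta> / (1 + l))"] by auto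
    then have s: "s > 0" "s < \<delta>" "s * (1 + l) < \<eta>"
      using \<open>0 \<le> l\<close> by (simp_all add: pos_less_divide_eq)
    define h where "h = (s / norm u) *\<^sub>R u"
    have h: "norm h = s" "u \<bullet> h = s * norm u"
      using u s by (simp_all add: h_def dot_square_norm power2_eq_square)
    obtain b' where b': "(a + h, b') \<in> \<Omega>" "norm (b' - b) \<le> l * s"
      using follow[of "a + h"] h s by auto
    have diff: "(a + h, b') - (a, b) = (h, b' - b)" by simp
    have nd: "norm (h, b' - b) \<le> s * (1 + l)"
      using norm_Pair_le[of h "b' - b"] b' h by (simp add: algebra_simps)
    then have "u \<bullet> h + w \<bullet> (b' - b) \<le> \<epsilon> * norm (h, b' - b)"
      using bspec[OF \<eta> b'(1)] s(3) unfolding diff by simp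
    also have "\<dots> \<le> \<epsilon> * (s * (1 + l))" using nd \<open>\<epsilon> > 0\<close> by simp
    also have "\<dots> = s * e" using \<open>0 \<le> l\<close> by (simp add: \<epsilon>_def)
    finally have "s * norm u \<le> s * e - w \<bullet> (b' - b)" using h by simp
    moreover have "- (w \<bullet> (b' - b)) \<le> norm w * norm (b' - b)"
      using Cauchy_Schwarz_ineq2[of w "b' - b"] by linarith
    moreover have "norm w * norm (b' - b) \<le> norm w * (l * s)" using b' by (simp add: mult_left_mono)
    ultimately have "s * norm u \<le> s * (l * norm w + e)" by (simp add: algebra_simps)
    then show "norm u \<le> l * norm w + e" using s by simp
  qed
qed (use \<open>0 \<le> l\<close> in simp)

section \<open>The distance function of a set-valued mapping\<close>

lemma gph_iff [simp]: "(x, y) \<in> gph F \<longleftrightarrow> y \<in> F x"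
  by (simp add: gph_def)

lemma closed_values:
  assumes "closed (gph F)"
  shows "closed (F x)"
proof -
  have "F x = Pair x -` gph F" by (auto simp: gph_def)
  then show ?thesis using assms by (simp add: closed_vimage continuous_on_Pair)
qed

lemma dist_map_empty: "F x = {} \<Longrightarrow> dist_map F (x, y) = \<infinity>"
  by (simp add: dist_map_def top_ereal_def)

lemma dist_map_nearest:
  fixes F :: "'a \<Rightarrow> 'b::{real_normed_vector, heine_borel} set"
  assumes "closed (F x)" "F x \<noteq> {}"
  obtains p where "p \<in> F x" "dist_map F (x, y) = ereal (norm (y - p))"
proof -
  obtain p where p: "p \<in> F x" "infdist y (F x) = dist y p"
    using infdist_attains_inf[OF assms] by blast
  have "dist_map F (x, y) = ereal (norm (y - p))"
    unfolding dist_map_def prod.case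
  proof (rule INF_eqI)
    fix v assume "v \<in> F x"
    then show "ereal (norm (y - p)) \<le> ereal (norm (y - v))"
      using p infdist_le[of v "F x" y] by (simp add: dist_norm)
  qed (use p in auto)
  with p show ?thesis using that by blast
qed

lemma dist_map_le: "v \<in> F x \<Longrightarrow> dist_map F (x, y) \<le> ereal (norm (y - v))"
  unfolding dist_map_def prod.case by (rule INF_lower)

lemma dist_map_nonneg: "0 \<le> dist_map F p"
  by (cases p) (auto simp: dist_map_def intro!: INF_greatest)

lemma dist_map_gph: "y \<in> F x \<Longrightarrow> dist_map F (x, y) = 0"
  using dist_map_le[of y F x y] dist_map_nonneg[of F "(x, y)"] by (simp add: zero_ereal_def)

text \<open>A graph normal \<open>(u, w)\<close> with \<open>norm w < 1\<close> is already a subgradient of the distance function: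
  passing from \<open>(x, y)\<close> to the nearest graph point \<open>(x, p)\<close> costs at most \<open>norm w * norm (y - p)\<close>,
  which the distance \<open>norm (y - p)\<close> dominates with room for the error of the normal inequality.\<close>

lemma regular_normal_subgradient_dist_map:
  fixes F :: "'a::euclidean_space \<Rightarrow> 'b::euclidean_space set"
  assumes "closed (gph F)" "y \<in> F x"
    and normal: "(u, w) \<in> regular_normal_cone (gph F) (x, y)"
    and "norm w < 1"
  shows "(u, w) \<in> limiting_subdifferential (dist_map F) (x, y)"
proof -
  have "((u, w), -1) \<in> regular_normal_cone (epi (dist_map F)) ((x, y), 0::real)"
    unfolding regular_normal_cone_iff
  proof (intro allI impI)
    fix \<epsilon> :: real assume "\<epsilon> > 0"
    define \<epsilon>' where "\<epsilon>' = min \<epsilon> (1 - norm w)"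
    have \<epsilon>': "\<epsilon>' > 0" "\<epsilon>' \<le> \<epsilon>" "\<epsilon>' + norm w \<le> 1"
      using \<open>\<epsilon> > 0\<close> \<open>norm w < 1\<close> by (auto simp: \<epsilon>'_def)
    then obtain \<eta> where "\<eta> > 0" and \<eta>: "\<forall>z'\<in>gph F. norm (z' - (x, y)) < \<eta> \<longrightarrow>
        (u, w) \<bullet> (z' - (x, y)) \<le> \<epsilon>' * norm (z' - (x, y))"
      using normal unfolding regular_normal_cone_iff by blast
    define M where "M = norm (u, w) + 1"
    have M: "M > 0" "norm (u, w) \<le> M" by (simp_all add: M_def add_nonneg_pos)
    define \<delta> where "\<delta> = min (\<eta> / 2) (\<eta> / 2 / M)"
    have "\<delta> > 0" using \<open>\<eta> > 0\<close> M by (simp add: \<delta>_def)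
    have key: "(u, w) \<bullet> (z - (x, y)) \<le> r + \<epsilon> * norm (z - (x, y))"
      if z: "dist_map F z \<le> ereal r" "norm (z - (x, y)) < \<delta>" for z r
    proof -
      obtain x' y' where zxy: "z = (x', y')" by force
      have "F x' \<noteq> {}" using z dist_map_empty[of F x' y'] zxy by auto
      then obtain p where p: "p \<in> F x'" "dist_map F (x', y') = ereal (norm (y' - p))"
        using dist_map_nearest closed_values[OF assms(1)] by metis
      have r: "norm (y' - p) \<le> r" using z p zxy by simp
      have split: "z - (x, y) = ((x', p) - (x, y)) + (0, y' - p)" by (simp add: zxy)
      have le: "norm ((x', p) - (x, y)) \<le> norm (z - (x, y)) + norm (y' - p)"
        using norm_triangle_ineq4[of "z - (x, y)" "(0, y' - p)"] split by simp
      show ?thesis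
      proof (cases "norm (y' - p) < \<eta> / 2")
        case True
        have "norm (z - (x, y)) < \<eta> / 2" using z by (simp add: \<delta>_def)
        then have "norm ((x', p) - (x, y)) < \<eta>" using True le by linarith
        then have "(u, w) \<bullet> ((x', p) - (x, y)) \<le> \<epsilon>' * norm ((x', p) - (x, y))"
          using \<eta> p(1) by (meson gph_iff)
        also have "\<dots> \<le> \<epsilon>' * (norm (z - (x, y)) + norm (y' - p))"
          using le \<epsilon>' by simp
        finally have "(u, w) \<bullet> ((x', p) - (x, y)) \<le> \<epsilon>' * (norm (z - (x, y)) + norm (y' - p))" .
        moreover have "w \<bullet> (y' - p) \<le> norm w * norm (y' - p)" by (rule norm_cauchy_schwarz)
        moreover have "(u, w) \<bullet> (z - (x, y)) = (u, w) \<bullet> ((x', p) - (x, y)) + w \<bullet> (y' - p)"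
          unfolding split inner_add_right by simp
        ultimately have "(u, w) \<bullet> (z - (x, y)) \<le>
            \<epsilon>' * norm (z - (x, y)) + (\<epsilon>' + norm w) * norm (y' - p)"
          by (simp add: algebra_simps)
        also have "\<dots> \<le> \<epsilon> * norm (z - (x, y)) + 1 * norm (y' - p)"
          using \<epsilon>' by (intro add_mono mult_right_mono) auto
        finally show ?thesis using r by linarith
      next
        case False
        \<comment> \<open>The normal inequality says nothing about \<open>p\<close>, but the distance exceeds the linear term.\<close>
        have "(u, w) \<bullet> (z - (x, y)) \<le> norm (u, w) * norm (z - (x, y))"
          by (rule norm_cauchy_schwarz)
        also have "\<dots> \<le> M * (\<eta> / 2 / M)"
          using M z by (intro mult_mono) (auto simp: \<delta>_def)
        also have "\<dots> = \<eta> / 2" using M by simp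
        also have "\<dots> \<le> r" using False r by linarith
        also have "\<dots> \<le> r + \<epsilon> * norm (z - (x, y))" using \<open>\<epsilon> > 0\<close> by simp
        finally show ?thesis .
      qed
    qed
    have "((u, w), -1) \<bullet> (q - ((x, y), 0)) \<le> \<epsilon> * norm (q - ((x, y), 0))"
      if q: "q \<in> epi (dist_map F)" "norm (q - ((x, y), 0)) < \<delta>" for q
    proof -
      obtain z r where zr: "q = (z, r)" by (cases q)
      have n: "norm (z - (x, y)) \<le> norm (q - ((x, y), 0))"
        using norm_fst_le[of "z - (x, y)" r] by (simp add: zr)
      then have "(u, w) \<bullet> (z - (x, y)) \<le> r + \<epsilon> * norm (z - (x, y))"
        using q key zr by (auto simp: epi_def)
      also have "\<dots> \<le> r + \<epsilon> * norm (q - ((x, y), 0))" using n \<open>\<epsilon> > 0\<close> by simp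
      finally show ?thesis by (simp add: zr)
    qed
    with \<open>\<delta> > 0\<close> show "\<exists>\<delta>>0. \<forall>q\<in>epi (dist_map F). norm (q - ((x, y), 0)) < \<delta> \<longrightarrow>
        ((u, w), -1) \<bullet> (q - ((x, y), 0)) \<le> \<epsilon> * norm (q - ((x, y), 0))"
      by blast
  qed
  moreover have "((x, y), 0::real) \<in> epi (dist_map F)"
    using dist_map_gph[of y F x, OF assms(2)] by (simp add: epi_def)
  ultimately have "((u, w), -1) \<in> limiting_normal_cone (epi (dist_map F)) ((x, y), 0::real)"
    using regular_subset_limiting_normal_cone by blast
  then show ?thesis
    using dist_map_gph[of y F x, OF assms(2)] by (simp add: limiting_subdifferential_def)
qed

text \<open>The epigraph of an \<open>l\<close>-Lipschitz function can be followed at speed \<open>l\<close> from each of its points,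
  those above the graph included, so its normals \<open>(\<xi>, s)\<close> satisfy \<open>norm \<xi> \<le> l * \<bar>s\<bar>\<close>.  The bound
  survives the limit, where \<open>s = -1\<close>.\<close>

lemma subgradient_norm_le_lipschitz:
  fixes f :: "'a::real_inner \<Rightarrow> ereal"
  assumes lip: "finite_lipschitz_on l U f" and "z \<in> interior U"
    and u: "u \<in> limiting_subdifferential f z"
  shows "norm u \<le> l"
proof -
  have fin: "\<And>z. z \<in> U \<Longrightarrow> \<bar>f z\<bar> \<noteq> \<infinity>" and L: "l-lipschitz_on U (\<lambda>z. real_of_ereal (f z))"
    using lip by (auto simp: finite_lipschitz_on_def)
  have "0 \<le> l" using L by (rule lipschitz_on_nonneg)
  obtain qs \<xi>s where q: "\<And>k. qs k \<in> epi f" and qlim: "qs \<longlonglongrightarrow> (z, real_of_ereal (f z))"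
    and \<xi>: "\<And>k. \<xi>s k \<in> regular_normal_cone (epi f) (qs k)" and \<xi>lim: "\<xi>s \<longlonglongrightarrow> (u, -1)"
    using u unfolding limiting_subdifferential_def limiting_normal_cone_def by auto
  have "(\<lambda>k. fst (qs k)) \<longlonglongrightarrow> z" using tendsto_fst[OF qlim] by simp
  then have "\<forall>\<^sub>F k in sequentially. fst (qs k) \<in> interior U"
    using \<open>z \<in> interior U\<close> topological_tendstoD by blast
  then have le: "\<forall>\<^sub>F k in sequentially. norm (fst (\<xi>s k)) \<le> l * norm (snd (\<xi>s k))"
  proof eventually_elim
    case (elim k)
    obtain \<delta> where "\<delta> > 0" and \<delta>: "ball (fst (qs k)) \<delta> \<subseteq> U"
      using elim open_contains_ball[of "interior U"] interior_subset by (metis open_interior subset_trans)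
    show ?case
    proof (rule regular_normal_bound[OF _ \<open>0 \<le> l\<close> \<open>\<delta> > 0\<close>])
      show "(fst (\<xi>s k), snd (\<xi>s k)) \<in> regular_normal_cone (epi f) (fst (qs k), snd (qs k))"
        using \<xi> by simp
      fix z' assume z': "norm (z' - fst (qs k)) < \<delta>"
      have U: "fst (qs k) \<in> U" "z' \<in> U"
        using \<delta> z' \<open>\<delta> > 0\<close> by (auto simp: subset_iff dist_norm norm_minus_commute)
      have "real_of_ereal (f (fst (qs k))) \<le> snd (qs k)"
        using q[of k] fin[OF U(1)] by (cases "f (fst (qs k))") (auto simp: epi_def case_prod_beta)
      moreover have "real_of_ereal (f z') - real_of_ereal (f (fst (qs k))) \<le> l * norm (z' - fst (qs k))"
        using lipschitz_onD[OF L U(2,1)] by (simp add: dist_norm)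
      ultimately have "real_of_ereal (f z') \<le> snd (qs k) + l * norm (z' - fst (qs k))" by linarith
      then have "(z', snd (qs k) + l * norm (z' - fst (qs k))) \<in> epi f"
        using fin[OF U(2)] by (cases "f z'") (auto simp: epi_def)
      then show "\<exists>r. (z', r) \<in> epi f \<and> norm (r - snd (qs k)) \<le> l * norm (z' - fst (qs k))"
        using \<open>0 \<le> l\<close> by (intro exI conjI) auto
    qed
  qed
  have "(\<lambda>k. norm (fst (\<xi>s k))) \<longlonglongrightarrow> norm u"
    using tendsto_norm[OF tendsto_fst[OF \<xi>lim]] by simp
  moreover have "(\<lambda>k. l * norm (snd (\<xi>s k))) \<longlonglongrightarrow> l"
    using tendsto_mult_left[OF tendsto_norm[OF tendsto_snd[OF \<xi>lim]], of l] by simp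
  ultimately show ?thesis
    using tendsto_le[OF sequentially_bot _ _ le] by blast
qed

section \<open>Following the graph from a normal cone bound\<close>

text \<open>With \<open>d = norm (x' - x0)\<close> a minimiser \<open>(x, y)\<close> of \<open>norm (x - x') + a * (norm (y - y0))\<^sup>2\<close> over the
  graph has value at most \<open>d\<close>, the value at \<open>(x0, y0)\<close>.  This confines \<open>(x, y)\<close> to the region where
  normals are controlled and makes the penalty gradient at most \<open>2 * sqrt (a * d)\<close>, which is below
  \<open>1 / l\<close> for the \<open>a\<close> chosen.  Squaring the penalty keeps it differentiable at \<open>y = y0\<close>, so that no
  sum rule for nonsmooth functions enters.\<close>

lemma selection_from_normal_bound:
  fixes F :: "'a::euclidean_space \<Rightarrow> 'b::euclidean_space set"
  assumes "closed (gph F)" "y0 \<in> F x0" "0 < l"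
    and bound: "\<And>x y u v. \<lbrakk>y \<in> F x; norm (x - x0) \<le> 2 * norm (x' - x0);
        norm (y - y0) \<le> 3 * l * norm (x' - x0);
        (u, - v) \<in> regular_normal_cone (gph F) (x, y)\<rbrakk> \<Longrightarrow> norm u \<le> l * norm v"
  shows "\<exists>y'\<in>F x'. norm (y' - y0) \<le> 3 * l * norm (x' - x0)"
proof (cases "x' = x0")
  case False
  define d where "d = norm (x' - x0)"
  have "d > 0" using False by (simp add: d_def)
  \<comment> \<open>Value at most \<open>d\<close> then means \<open>norm (y - y0) \<le> 3 * l * d\<close>, and \<open>l\<close> times the penalty gradient
    is at most \<open>2 / 3\<close>.\<close>
  define a where "a = 1 / (9 * l\<^sup>2 * d)"
  have "a > 0" using \<open>d > 0\<close> \<open>0 < l\<close> by (simp add: a_def)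
  define \<phi> where "\<phi> = (\<lambda>q. norm (fst q - x') + a * ((snd q - y0) \<bullet> (snd q - y0)))"
  define K where "K = gph F \<inter> (cball x' d \<times> cball y0 (3 * l * d))"
  have "compact K"
    unfolding K_def using assms(1) by (intro closed_Int_compact compact_Times compact_cball)
  moreover have base: "(x0, y0) \<in> K"
    using assms(2) \<open>0 < l\<close> \<open>d > 0\<close> by (simp add: K_def d_def dist_norm)
  moreover have "continuous_on K \<phi>" unfolding \<phi>_def by (intro continuous_intros)
  ultimately obtain q where q: "q \<in> K" and qmin: "\<And>q'. q' \<in> K \<Longrightarrow> \<phi> q \<le> \<phi> q'"
    using continuous_attains_inf[of K \<phi>] by blast
  obtain x y where xy: "q = (x, y)" by force
  have \<phi>0: "\<phi> (x0, y0) = d" by (simp add: \<phi>_def d_def norm_minus_commute)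
  have ad: "a * (3 * l * d)\<^sup>2 = d"
    using \<open>0 < l\<close> \<open>d > 0\<close> by (simp add: a_def power2_eq_square)
  \<comment> \<open>Outside \<open>K\<close> one of the two terms alone exceeds \<open>d\<close>, so the minimum over \<open>K\<close> is global.\<close>
  have gmin: "\<phi> q \<le> \<phi> q'" if gph: "q' \<in> gph F" for q'
  proof (cases "q' \<in> K")
    case False
    obtain x1 y1 where q': "q' = (x1, y1)" by force
    have sq: "(y1 - y0) \<bullet> (y1 - y0) = (norm (y1 - y0))\<^sup>2" by (simp add: power2_norm_eq_inner)
    consider "norm (x1 - x') > d" | "norm (y1 - y0) > 3 * l * d"
      using False gph unfolding K_def q'
      by (auto simp: dist_norm norm_minus_commute[of x'] norm_minus_commute[of y0] not_le simp del: gph_iff)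
    then have "d \<le> \<phi> q'"
    proof cases
      case 1
      moreover have "0 \<le> a * (norm (y1 - y0))\<^sup>2" using \<open>a > 0\<close> by simp
      ultimately show ?thesis by (simp add: \<phi>_def q' sq)
    next
      case 2
      then have "(3 * l * d)\<^sup>2 \<le> (norm (y1 - y0))\<^sup>2"
        using \<open>0 < l\<close> \<open>d > 0\<close> by (intro power_mono) auto
      then have "d \<le> a * (norm (y1 - y0))\<^sup>2"
        using \<open>a > 0\<close> ad by (metis mult_left_mono less_imp_le)
      then show ?thesis by (simp add: \<phi>_def q' sq add_increasing)
    qed
    then show ?thesis using qmin[OF base] \<phi>0 by linarith
  qed (rule qmin)
  have yF: "y \<in> F x" and xd: "norm (x - x') \<le> d" and yd: "norm (y - y0) \<le> 3 * l * d"
    using q by (auto simp: K_def xy dist_norm norm_minus_commute)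
  have "x = x'"
  proof (rule ccontr)
    assume "x \<noteq> x'"
    then have der: "(\<phi> has_derivative (\<lambda>h. (sgn (x - x'), (2 * a) *\<^sub>R (y - y0)) \<bullet> h)) (at (x, y))"
    proof -
      have "((\<lambda>q. norm (fst q - x')) has_derivative (\<lambda>h. fst h \<bullet> sgn (x - x'))) (at (x, y))"
      proof (rule has_derivative_compose[of "\<lambda>q. fst q - x'" fst _ _ norm "\<lambda>h. h \<bullet> sgn (x - x')"])
        show "((\<lambda>q. fst q - x') has_derivative fst) (at (x, y))"
          by (auto intro!: derivative_eq_intros)
        show "(norm has_derivative (\<lambda>h. h \<bullet> sgn (x - x'))) (at (fst (x, y) - x'))"
          using GDERIV_norm[of "x - x'"] \<open>x \<noteq> x'\<close> by (simp add: gderiv_def)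
      qed
      moreover have "((\<lambda>q. a * ((snd q - y0) \<bullet> (snd q - y0))) has_derivative
          (\<lambda>h. (2 * a) *\<^sub>R (y - y0) \<bullet> snd h)) (at (x, y))"
        by (auto intro!: derivative_eq_intros simp: fun_eq_iff inner_commute)
      ultimately show ?thesis
        unfolding \<phi>_def
        by (rule has_derivative_eq_rhs[OF has_derivative_add])
          (auto simp: fun_eq_iff inner_prod_def inner_commute)
    qed
    have "- (sgn (x - x'), (2 * a) *\<^sub>R (y - y0)) \<in> regular_normal_cone (gph F) (x, y)"
      using minimiser_regular_normal[OF der] gmin xy by blast
    then have "norm (- sgn (x - x')) \<le> l * norm ((2 * a) *\<^sub>R (y - y0))"
      using norm_triangle_ineq[of "x - x'" "x' - x0"] xd yd yF
      by (intro bound[of y x]) (auto simp: d_def)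
    also have "\<dots> = l * (2 * a * norm (y - y0))" using \<open>a > 0\<close> by simp
    also have "\<dots> \<le> l * (2 * a * (3 * l * d))"
      using yd \<open>0 < l\<close> \<open>a > 0\<close> by (intro mult_left_mono) auto
    also have "\<dots> = 2 / 3"
      using \<open>0 < l\<close> \<open>d > 0\<close> by (simp add: a_def power2_eq_square)
    finally show False using \<open>x \<noteq> x'\<close> by (simp add: norm_sgn)
  qed
  then show ?thesis using yF yd by (auto simp: d_def)
qed (use assms(2) in auto)

section \<open>Behaviour near infinity\<close>

text \<open>The common local consequence of (ii) and (iii).  Only the constant \<open>l\<close> is uniform: the radius
  \<open>\<delta>\<close> may depend on the point, since testing a normal uses arbitrarily short steps only.\<close>

definition lower_lipschitz_near_infinity  ::
    "('a::real_normed_vector \<Rightarrow> 'b::real_normed_vector set) \<Rightarrow> 'b \<Rightarrow> bool" where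
  "lower_lipschitz_near_infinity F ybar \<longleftrightarrow>
     (\<exists>R>0. \<exists>l>0. \<exists>\<rho>>0. \<forall>x y. y \<in> F x \<longrightarrow> R < norm x \<longrightarrow> norm (y - ybar) < \<rho> \<longrightarrow>
     (\<exists>\<delta>>0. \<forall>x'. norm (x' - x) < \<delta> \<longrightarrow> (\<exists>y'\<in>F x'. norm (y' - y) \<le> l * norm (x' - x))))"

lemma eventually_near_infinity:
  assumes "filterlim (\<lambda>k. norm (xs k)) at_top sequentially" "ys \<longlonglongrightarrow> ybar" "0 < \<rho>"
  shows "\<forall>\<^sub>F k in sequentially. R < norm (xs k) \<and> norm (ys k - ybar) < \<rho>"
  using filterlim_at_top_dense[THEN iffD1, OF assms(1), rule_format, of R]
    tendstoD[OF assms(2,3)]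
  by eventually_elim (simp add: dist_norm)

lemma zero_in_coderivative_at_infinity:
  assumes "ybar \<in> jelonek_set F"
  shows "0 \<in> coderivative_at_infinity F ybar 0"
proof -
  have "(0, 0) \<in> normal_cone_at_infinity (gph F) ybar"
    using assms zero_in_regular_normal_cone[of "gph F"]
    unfolding jelonek_set_def normal_cone_at_infinity_def zero_prod_def
    by (force intro: exI[of _ "\<lambda>_. (0, 0)"])
  then show ?thesis by (simp add: coderivative_at_infinity_def)
qed

lemma coderivative_trivial_if_lower_lipschitz:
  assumes jel: "ybar \<in> jelonek_set F"
    and fol: "lower_lipschitz_near_infinity F ybar"
  shows "coderivative_at_infinity F ybar 0 = {0}"
proof -
  obtain R l \<rho> where "l > 0" "\<rho> > 0" and
    fol: "\<And>x y. \<lbrakk>y \<in> F x; R < norm x; norm (y - ybar) < \<rho>\<rbrakk> \<Longrightarrow>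
      \<exists>\<delta>>0. \<forall>x'. norm (x' - x) < \<delta> \<longrightarrow> (\<exists>y'\<in>F x'. norm (y' - y) \<le> l * norm (x' - x))"
    using fol unfolding lower_lipschitz_near_infinity_def by blast
  have "u = 0" if u: "u \<in> coderivative_at_infinity F ybar 0" for u
  proof -
    obtain xs ys \<xi>s where s: "\<And>k. (xs k, ys k) \<in> gph F"
      "filterlim (\<lambda>k. norm (xs k)) at_top sequentially" "ys \<longlonglongrightarrow> ybar"
      and \<xi>: "\<And>k. \<xi>s k \<in> regular_normal_cone (gph F) (xs k, ys k)" and \<xi>lim: "\<xi>s \<longlonglongrightarrow> (u, 0)"
      using u unfolding coderivative_at_infinity_def normal_cone_at_infinity_def by auto
    have le: "\<forall>\<^sub>F k in sequentially. norm (fst (\<xi>s k)) \<le> l * norm (snd (\<xi>s k))"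
      using eventually_near_infinity[OF s(2,3) \<open>\<rho> > 0\<close>, of R]
    proof eventually_elim
      case (elim k)
      obtain \<delta> where "\<delta> > 0" and
        \<delta>: "\<forall>x'. norm (x' - xs k) < \<delta> \<longrightarrow> (\<exists>y'\<in>F x'. norm (y' - ys k) \<le> l * norm (x' - xs k))"
        using fol[of "ys k" "xs k"] s(1) elim by auto
      show ?case
      proof (rule regular_normal_bound[OF _ _ \<open>\<delta> > 0\<close>])
        show "(fst (\<xi>s k), snd (\<xi>s k)) \<in> regular_normal_cone (gph F) (xs k, ys k)"
          using \<xi> by simp
      qed (use \<delta> \<open>l > 0\<close> in auto)
    qed
    have "(\<lambda>k. norm (fst (\<xi>s k))) \<longlonglongrightarrow> norm u"
      using tendsto_norm[OF tendsto_fst[OF \<xi>lim]] by simp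
    moreover have "(\<lambda>k. l * norm (snd (\<xi>s k))) \<longlonglongrightarrow> 0"
      using tendsto_mult_left[OF tendsto_norm[OF tendsto_snd[OF \<xi>lim]], of l] by simp
    ultimately have "norm u \<le> 0"
      using tendsto_le[OF sequentially_bot _ _ le] by blast
    then show "u = 0" by simp
  qed
  then show ?thesis using zero_in_coderivative_at_infinity[OF jel] by blast
qed

text \<open>One constant \<open>l\<close> serves as radius, inverse neighbourhood size and modulus, so that the negation
  directly provides a sequence with \<open>l = k + 1\<close>.  Violating normals scaled to \<open>norm u = 1\<close> have
  \<open>norm v < 1 / (k + 1)\<close> and accumulate at some \<open>(e, 0)\<close> with \<open>norm e = 1\<close>.\<close>

lemma normal_bound_near_infinity:
  fixes F :: "'a::euclidean_space \<Rightarrow> 'b::euclidean_space set"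
  assumes triv: "coderivative_at_infinity F ybar 0 = {0}"
  obtains l where "l > 0"
    "\<And>x y u v. \<lbrakk>y \<in> F x; l < norm x; norm (y - ybar) < 1 / l;
       (u, - v) \<in> regular_normal_cone (gph F) (x, y)\<rbrakk> \<Longrightarrow> norm u \<le> l * norm v"
proof (rule ccontr)
  assume contra: "\<not> thesis"
  have "\<exists>x y u v. y \<in> F x \<and> real (Suc k) < norm x \<and> norm (y - ybar) < 1 / real (Suc k) \<and>
      (u, - v) \<in> regular_normal_cone (gph F) (x, y) \<and> real (Suc k) * norm v < norm u" for k
    using contra that[of "real (Suc k)"] by (meson not_le of_nat_0_less_iff zero_less_Suc)
  then obtain xs ys us vs where F: "\<And>k. ys k \<in> F (xs k)"
    and x: "\<And>k. real (Suc k) < norm (xs k)" and y: "\<And>k. norm (ys k - ybar) < 1 / real (Suc k)"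
    and uv: "\<And>k. (us k, - vs k) \<in> regular_normal_cone (gph F) (xs k, ys k)"
    and lt: "\<And>k. real (Suc k) * norm (vs k) < norm (us k)"
    by metis
  have upos: "norm (us k) > 0" for k
    using lt[of k] by (meson le_less_trans mult_nonneg_nonneg norm_ge_zero of_nat_0_le_iff)
  have xlim: "filterlim (\<lambda>k. norm (xs k)) at_top sequentially"
  proof (rule filterlim_at_top_mono[OF filterlim_real_sequentially])
    show "\<forall>\<^sub>F k in sequentially. real k \<le> norm (xs k)"
      using x by (intro always_eventually allI) (smt (verit) of_nat_Suc)
  qed
  have inv: "(\<lambda>k. 1 / real (Suc k)) \<longlonglongrightarrow> 0"
    using LIMSEQ_inverse_real_of_nat by (simp add: inverse_eq_divide)
  have ylim: "ys \<longlonglongrightarrow> ybar"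
    by (rule LIM_zero_cancel, rule Lim_null_comparison[OF _ inv]) (use less_imp_le[OF y] in simp)
  have "\<exists>e. norm e = 1 \<and> e \<in> coderivative_at_infinity F ybar 0"
  proof -
    have "bounded (range (\<lambda>k. sgn (us k)))"
      by (auto simp: bounded_iff norm_sgn intro!: exI[of _ 1])
    then obtain e r where r: "strict_mono r" and e: "(\<lambda>k. sgn (us (r k))) \<longlonglongrightarrow> e"
      using bounded_imp_convergent_subsequence[of "\<lambda>k. sgn (us k)"] by (auto simp: o_def)
    define ws where "ws k = inverse (norm (us k)) *\<^sub>R vs k" for k
    have "norm (ws k) \<le> 1 / real (Suc k)" for k
      using lt[of k] upos[of k] by (simp add: ws_def field_simps)
    then have w: "ws \<longlonglongrightarrow> 0"
      by (intro Lim_null_comparison[OF _ inv]) auto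
    have "norm e = 1"
      using LIMSEQ_unique[OF tendsto_norm[OF e], of 1] upos by (simp add: norm_sgn)
    moreover have "(\<lambda>k. (sgn (us (r k)), - ws (r k))) \<longlonglongrightarrow> (e, - 0)"
      using LIMSEQ_subseq_LIMSEQ[OF w r] by (intro tendsto_intros e) (simp add: o_def)
    moreover have "(sgn (us k), - ws k) \<in> regular_normal_cone (gph F) (xs k, ys k)" for k
      using regular_normal_cone_scaleR[OF uv[of k], of "inverse (norm (us k))"] upos[of k]
      by (simp add: ws_def sgn_div_norm)
    moreover have "filterlim (\<lambda>k. norm (xs (r k))) at_top sequentially"
      using filterlim_compose[OF xlim filterlim_subseq[OF r]] .
    moreover have "(\<lambda>k. ys (r k)) \<longlonglongrightarrow> ybar"
      using LIMSEQ_subseq_LIMSEQ[OF ylim r] by (simp add: o_def)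
    ultimately show ?thesis
      unfolding coderivative_at_infinity_def normal_cone_at_infinity_def mem_Collect_eq
      using F by (intro exI[of _ e] conjI exI[of _ "\<lambda>k. xs (r k)"] exI[of _ "\<lambda>k. ys (r k)"]
        exI[of _ "\<lambda>k. (sgn (us (r k)), - ws (r k))"]) auto
  qed
  then show False using triv by auto
qed

text \<open>The step bound \<open>c\<close> does not depend on the point.  This is what makes the inclusion in (ii) hold
  for all pairs of arguments and not just for neighbouring ones.\<close>

lemma uniform_selection_near_infinity:
  fixes F :: "'a::euclidean_space \<Rightarrow> 'b::euclidean_space set"
  assumes cl: "closed (gph F)" and triv: "coderivative_at_infinity F ybar 0 = {0}"
  obtains R l \<rho> c where "R > 0" "l > 0" "\<rho> > 0" "c > 0"
    "\<And>x y x'. \<lbrakk>y \<in> F x; R < norm x; norm (y - ybar) < \<rho>; norm (x' - x) \<le> c\<rbrakk> \<Longrightarrow>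
      \<exists>y'\<in>F x'. norm (y' - y) \<le> l * norm (x' - x)"
proof -
  obtain l where "l > 0" and l: "\<And>x y u v. \<lbrakk>y \<in> F x; l < norm x; norm (y - ybar) < 1 / l;
       (u, - v) \<in> regular_normal_cone (gph F) (x, y)\<rbrakk> \<Longrightarrow> norm u \<le> l * norm v"
    using normal_bound_near_infinity[OF triv] by blast
  \<comment> \<open>The minimisation wanders at most \<open>2 * c\<close> in \<open>x\<close> and \<open>3 * l * c\<close> in \<open>y\<close>; this must stay within
    the margins \<open>1\<close> and \<open>1 / (2 * l)\<close> left below.\<close>
  define c where "c = min (1 / 2) (1 / (6 * l\<^sup>2))"
  have c: "c > 0" "2 * c \<le> 1" "3 * l * c \<le> 1 / (2 * l)"
  proof -
    show "c > 0" "2 * c \<le> 1" using \<open>l > 0\<close> by (auto simp: c_def)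
    have "3 * l * c \<le> 3 * l * (1 / (6 * l\<^sup>2))"
      using \<open>l > 0\<close> by (intro mult_left_mono) (auto simp: c_def)
    also have "\<dots> = 1 / (2 * l)" using \<open>l > 0\<close> by (simp add: power2_eq_square)
    finally show "3 * l * c \<le> 1 / (2 * l)" .
  qed
  show ?thesis
  proof (rule that[of "l + 1" "3 * l" "1 / (2 * l)" c])
    fix x y x' assume *: "y \<in> F x" "l + 1 < norm x" "norm (y - ybar) < 1 / (2 * l)" "norm (x' - x) \<le> c"
    show "\<exists>y'\<in>F x'. norm (y' - y) \<le> 3 * l * norm (x' - x)"
    proof (rule selection_from_normal_bound[OF cl *(1) \<open>l > 0\<close>])
      fix x1 y1 u v
      assume 1: "y1 \<in> F x1" "norm (x1 - x) \<le> 2 * norm (x' - x)" "norm (y1 - y) \<le> 3 * l * norm (x' - x)"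
        and n: "(u, - v) \<in> regular_normal_cone (gph F) (x1, y1)"
      have "l < norm x1"
        using norm_triangle_ineq2[of x "x - x1"] norm_minus_commute[of x x1] 1(2) c(2) *(2,4) by simp
      moreover have "norm (y1 - ybar) < 1 / l"
      proof -
        have "3 * l * norm (x' - x) \<le> 3 * l * c" using *(4) \<open>l > 0\<close> by simp
        then have "norm (y1 - y) \<le> 1 / (2 * l)" using 1(3) c(3) by linarith
        moreover have "norm (y1 - ybar) \<le> norm (y1 - y) + norm (y - ybar)"
          using norm_triangle_ineq[of "y1 - y" "y - ybar"] by simp
        moreover have "1 / l = 1 / (2 * l) + 1 / (2 * l)" by simp
        ultimately show ?thesis using *(3) by linarith
      qed
      ultimately show "norm u \<le> l * norm v" using l 1(1) n by blast
    qed
  qed (use \<open>l > 0\<close> c in auto)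
qed

lemma scaled_unit_ball_iff:
  assumes "0 \<le> s"
  shows "v \<in> (*\<^sub>R) s ` cball 0 1 \<longleftrightarrow> norm v \<le> s"
proof
  assume "norm v \<le> s"
  then show "v \<in> (*\<^sub>R) s ` cball 0 1"
    using assms by (cases "s = 0") (auto intro!: image_eqI[of _ _ "v /\<^sub>R s"] simp: field_simps)
qed (use assms in \<open>auto simp: mult_left_le\<close>)

lemma lipschitz_like_if_coderivative_trivial:
  fixes F :: "'a::euclidean_space \<Rightarrow> 'b::euclidean_space set"
  assumes "closed (gph F)" "coderivative_at_infinity F ybar 0 = {0}"
  shows "\<exists>R>0. \<exists>l>0. \<exists>V. open V \<and> ybar \<in> V \<and> open (inv_map F V - cball 0 R) \<and>
          (\<forall>x \<in> inv_map F V - cball 0 R. \<forall>x' \<in> inv_map F V - cball 0 R.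
             F x \<inter> V \<subseteq> F x' + (*\<^sub>R) (l * norm (x - x')) ` cball 0 1)"
proof -
  obtain R l \<rho> c where pos: "R > 0" "l > 0" "\<rho> > 0" "c > 0" and
    sel: "\<And>x y x'. \<lbrakk>y \<in> F x; R < norm x; norm (y - ybar) < \<rho>; norm (x' - x) \<le> c\<rbrakk> \<Longrightarrow>
      \<exists>y'\<in>F x'. norm (y' - y) \<le> l * norm (x' - x)"
    using uniform_selection_near_infinity[OF assms] by blast
  define V where "V = ball ybar \<rho>"
  \<comment> \<open>The second entry covers arguments further apart than \<open>c\<close>, given that \<open>V\<close> has diameter \<open>2 * \<rho>\<close>.\<close>
  define l' where "l' = max l (2 * \<rho> / c)"
  have l': "l \<le> l'" "2 * \<rho> \<le> l' * c" "l' > 0"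
  proof -
    have "2 * \<rho> / c \<le> l'" by (simp add: l'_def)
    then show "2 * \<rho> \<le> l' * c" using pos by (simp add: field_simps)
  qed (use pos in \<open>auto simp: l'_def\<close>)
  have V: "y \<in> V \<longleftrightarrow> norm (y - ybar) < \<rho>" for y
    by (simp add: V_def dist_norm norm_minus_commute)
  have "open (inv_map F V - cball 0 R)"
    unfolding open_dist
  proof
    fix x assume "x \<in> inv_map F V - cball 0 R"
    then obtain y where y: "y \<in> F x" "norm (y - ybar) < \<rho>" "R < norm x"
      by (auto simp: inv_map_def V)
    define e where "e = min c (min (norm x - R) ((\<rho> - norm (y - ybar)) / l))"
    have "e > 0" using y pos by (simp add: e_def)
    moreover have "x' \<in> inv_map F V - cball 0 R" if "dist x' x < e" for x'
    proof -
      have d: "norm (x' - x) < e" using that by (simp add: dist_norm)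
      then obtain y' where y': "y' \<in> F x'" "norm (y' - y) \<le> l * norm (x' - x)"
        using sel[OF y(1,3,2), of x'] by (auto simp: e_def)
      have "norm (x' - x) < (\<rho> - norm (y - ybar)) / l" using d by (simp add: e_def)
      then have "l * norm (x' - x) < \<rho> - norm (y - ybar)" using pos by (simp add: field_simps)
      then have "norm (y' - ybar) < \<rho>"
        using y'(2) norm_triangle_ineq[of "y' - y" "y - ybar"] by simp
      moreover have "R < norm x'"
        using d norm_triangle_ineq2[of x "x - x'"] norm_minus_commute[of x x'] by (simp add: e_def)
      ultimately show ?thesis using y'(1) by (auto simp: inv_map_def V)
    qed
    ultimately show "\<exists>e>0. \<forall>x'. dist x' x < e \<longrightarrow> x' \<in> inv_map F V - cball 0 R" by blast
  qed
  moreover have "F x \<inter> V \<subseteq> F x' + (*\<^sub>R) (l' * norm (x - x')) ` cball 0 1"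
    if x: "x \<in> inv_map F V - cball 0 R" and x': "x' \<in> inv_map F V - cball 0 R" for x x'
  proof
    fix y assume "y \<in> F x \<inter> V"
    then have y: "y \<in> F x" "norm (y - ybar) < \<rho>" by (auto simp: V)
    have "\<exists>y'\<in>F x'. norm (y - y') \<le> l' * norm (x - x')"
    proof (cases "norm (x - x') \<le> c")
      case True
      then obtain y' where y': "y' \<in> F x'" "norm (y' - y) \<le> l * norm (x' - x)"
        using sel[OF y(1) _ y(2), of x'] x by (auto simp: norm_minus_commute)
      moreover have "l * norm (x' - x) \<le> l' * norm (x' - x)" using l' by (simp add: mult_right_mono)
      ultimately show ?thesis by (metis norm_minus_commute order_trans)
    next
      case False
      obtain y' where y': "y' \<in> F x'" "norm (y' - ybar) < \<rho>" using x' by (auto simp: inv_map_def V)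
      have "norm (y - y') \<le> 2 * \<rho>"
        using norm_triangle_ineq4[of "y - ybar" "y' - ybar"] y y' by simp
      also have "\<dots> \<le> l' * c" by (rule l')
      also have "\<dots> \<le> l' * norm (x - x')" using False l' by simp
      finally show ?thesis using y' by blast
    qed
    then obtain y' where y': "y' \<in> F x'" "norm (y - y') \<le> l' * norm (x - x')" by blast
    have "y - y' \<in> (*\<^sub>R) (l' * norm (x - x')) ` cball 0 1"
      using y'(2) l'(3) by (simp add: scaled_unit_ball_iff)
    then have "y' + (y - y') \<in> F x' + (*\<^sub>R) (l' * norm (x - x')) ` cball 0 1"
      using y'(1) by (rule set_plus_intro[rotated])
    then show "y \<in> F x' + (*\<^sub>R) (l' * norm (x - x')) ` cball 0 1" by simp
  qed
  moreover have "open V" "ybar \<in> V" using pos by (auto simp: V_def)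
  ultimately show ?thesis using pos l'(3) by blast
qed

lemma lower_lipschitz_if_lipschitz_like:
  fixes F :: "'a::euclidean_space \<Rightarrow> 'b::euclidean_space set"
  assumes "R > 0" "l > 0" "open V" "ybar \<in> V" and op: "open (inv_map F V - cball 0 R)"
    and lip: "\<And>x x'. \<lbrakk>x \<in> inv_map F V - cball 0 R; x' \<in> inv_map F V - cball 0 R\<rbrakk> \<Longrightarrow>
             F x \<inter> V \<subseteq> F x' + (*\<^sub>R) (l * norm (x - x')) ` cball 0 1"
  shows "lower_lipschitz_near_infinity F ybar"
proof -
  obtain \<rho> where "\<rho> > 0" and \<rho>: "ball ybar \<rho> \<subseteq> V"
    using \<open>open V\<close> \<open>ybar \<in> V\<close> open_contains_ball by blast
  have "\<exists>\<delta>>0. \<forall>x'. norm (x' - x) < \<delta> \<longrightarrow> (\<exists>y'\<in>F x'. norm (y' - y) \<le> l * norm (x' - x))"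
    if "y \<in> F x" "R < norm x" "norm (y - ybar) < \<rho>" for x y
  proof -
    have yV: "y \<in> V" using \<rho> that by (auto simp: subset_iff dist_norm norm_minus_commute)
    then have x: "x \<in> inv_map F V - cball 0 R" using that by (auto simp: inv_map_def)
    then obtain \<delta> where "\<delta> > 0" and \<delta>: "\<And>x'. norm (x' - x) < \<delta> \<Longrightarrow> x' \<in> inv_map F V - cball 0 R"
      using op unfolding open_dist dist_norm by blast
    have "\<exists>y'\<in>F x'. norm (y' - y) \<le> l * norm (x' - x)" if x': "norm (x' - x) < \<delta>" for x'
    proof -
      have "y \<in> F x' + (*\<^sub>R) (l * norm (x - x')) ` cball 0 1"
        using lip[OF x \<delta>[OF x']] yV \<open>y \<in> F x\<close> by blast
      then obtain y' b where "y' \<in> F x'" "norm b \<le> 1" "y = y' + (l * norm (x - x')) *\<^sub>R b"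
        by (auto elim!: set_plus_elim)
      moreover from this have "norm (y' - y) \<le> l * norm (x' - x)"
        using \<open>l > 0\<close> by (simp add: mult_left_le norm_minus_commute)
      ultimately show ?thesis by blast
    qed
    with \<open>\<delta> > 0\<close> show ?thesis by blast
  qed
  then show ?thesis using \<open>R > 0\<close> \<open>l > 0\<close> \<open>\<rho> > 0\<close> unfolding lower_lipschitz_near_infinity_def by blast
qed

text \<open>To compare the distance at \<open>(x, y)\<close> and \<open>(x', y')\<close>, carry the value nearest to \<open>y\<close> over to \<open>x'\<close>;
  this costs \<open>l * norm (x' - x)\<close> in addition to \<open>norm (y' - y)\<close>, whence the modulus \<open>1 + l\<close>.\<close>

lemma dist_locally_lipschitz_if_coderivative_trivial:
  fixes F :: "'a::euclidean_space \<Rightarrow> 'b::euclidean_space set"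
  assumes cl: "closed (gph F)" and "coderivative_at_infinity F ybar 0 = {0}"
  shows "\<exists>R>0. \<exists>l>0. \<exists>V. ybar \<in> interior V \<and> dist_locally_lipschitz F R l V"
proof -
  obtain R l \<rho> c where pos: "R > 0" "l > 0" "\<rho> > 0" "c > 0" and
    sel: "\<And>x y x'. \<lbrakk>y \<in> F x; R < norm x; norm (y - ybar) < \<rho>; norm (x' - x) \<le> c\<rbrakk> \<Longrightarrow>
      \<exists>y'\<in>F x'. norm (y' - y) \<le> l * norm (x' - x)"
    using uniform_selection_near_infinity[OF assms] by blast
  define V where "V = ball ybar (\<rho> / 2)"
  have "\<exists>U. (x0, y0) \<in> interior U \<and> finite_lipschitz_on (1 + l) U (dist_map F)"
    if "y0 \<in> F x0" "R < norm x0" "y0 \<in> V" for x0 y0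
  proof -
    have y0: "norm (y0 - ybar) < \<rho> / 2"
      using that by (simp add: V_def dist_norm norm_minus_commute)
    define e where "e = min (c / 2) (min (norm x0 - R) (\<rho> / 2 / (2 + l)))"
    have e: "e > 0" "2 * e \<le> c" "e \<le> norm x0 - R" "(2 + l) * e \<le> \<rho> / 2"
    proof -
      have "e \<le> \<rho> / 2 / (2 + l)" by (simp add: e_def)
      then show "(2 + l) * e \<le> \<rho> / 2" using pos by (simp add: field_simps)
      show "2 * e \<le> c" unfolding e_def min_def by (simp split: if_splits)
    qed (use that pos in \<open>auto simp: e_def\<close>)
    define U where "U = ball x0 e \<times> ball y0 e"
    have U: "(x, y) \<in> U \<longleftrightarrow> norm (x - x0) < e \<and> norm (y - y0) < e" for x y
      by (simp add: U_def dist_norm norm_minus_commute)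
    \<comment> \<open>The nearest value to \<open>y\<close> stays in the region where selections exist.\<close>
    have near: "\<exists>p\<in>F x. dist_map F (x, y) = ereal (norm (y - p)) \<and> R < norm x \<and> norm (p - ybar) < \<rho>"
      if "(x, y) \<in> U" for x y
    proof -
      have xy: "norm (x - x0) < e" "norm (y - y0) < e" using that U by auto
      obtain y1 where y1: "y1 \<in> F x" "norm (y1 - y0) \<le> l * norm (x - x0)"
        using sel[of y0 x0 x] \<open>y0 \<in> F x0\<close> \<open>R < norm x0\<close> y0 pos e xy by fastforce
      have "l * norm (x - x0) \<le> l * e" using xy pos by simp
      then have "norm (y1 - y0) \<le> l * e" using y1(2) by linarith
      obtain p where p: "p \<in> F x" "dist_map F (x, y) = ereal (norm (y - p))"
        using dist_map_nearest[of F x y] closed_values[OF cl] y1(1) by blast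
      have "norm (y - p) \<le> norm (y - y1)" using dist_map_le[of y1 F x y, OF y1(1)] p(2) by simp
      also have "\<dots> \<le> norm (y - y0) + norm (y1 - y0)"
        using norm_triangle_ineq4[of "y - y0" "y1 - y0"] by simp
      finally have "norm (y - p) \<le> (1 + l) * e"
        using xy \<open>norm (y1 - y0) \<le> l * e\<close> by (simp add: algebra_simps)
      moreover have "norm (p - ybar) \<le> norm (y - p) + norm (y - y0) + norm (y0 - ybar)"
        using norm_triangle_ineq4[of "y - ybar" "y - p"]
          norm_triangle_ineq[of "y - y0" "y0 - ybar"] by simp
      ultimately have "norm (p - ybar) < \<rho>" using xy y0 e by (simp add: algebra_simps)
      moreover have "R < norm x"
        using norm_triangle_ineq2[of x0 "x0 - x"] norm_minus_commute[of x x0] xy e by simp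
      ultimately show ?thesis using p by blast
    qed
    have fin: "\<bar>dist_map F z\<bar> \<noteq> \<infinity>" if "z \<in> U" for z
      using near[of "fst z" "snd z"] that by auto
    have est: "real_of_ereal (dist_map F z') \<le> real_of_ereal (dist_map F z) + (1 + l) * norm (z - z')"
      if zU: "z \<in> U" "z' \<in> U" for z z'
    proof -
      obtain x y x' y' where z: "z = (x, y)" "z' = (x', y')" by force
      obtain p where p: "p \<in> F x" "dist_map F (x, y) = ereal (norm (y - p))" "R < norm x"
        "norm (p - ybar) < \<rho>"
        using near zU z by blast
      have "norm (x' - x) \<le> norm (x' - x0) + norm (x - x0)"
        using norm_triangle_ineq4[of "x' - x0" "x - x0"] by simp
      then have "norm (x' - x) \<le> c" using zU e unfolding z U by linarith
      then obtain p' where p': "p' \<in> F x'" "norm (p' - p) \<le> l * norm (x' - x)"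
        using sel[OF p(1,3,4)] by blast
      have "real_of_ereal (dist_map F z') \<le> norm (y' - p')"
        using dist_map_le[of p' F x' y', OF p'(1)] fin[OF zU(2)] z by (cases "dist_map F z'") auto
      moreover have "norm (y' - p') \<le> norm (y' - y) + norm (y - p) + norm (p' - p)"
        using norm_triangle_ineq4[of "(y' - y) + (y - p)" "p' - p"]
          norm_triangle_ineq[of "y' - y" "y - p"] by simp
      moreover have "norm (y' - y) \<le> norm (z - z')"
        using norm_snd_le[of "y - y'" "x - x'"] z by (simp add: norm_minus_commute)
      moreover have "norm (p' - p) \<le> l * norm (z - z')"
      proof -
        have "norm (x' - x) \<le> norm (z - z')"
          using norm_fst_le[of "x - x'" "y - y'"] z by (simp add: norm_minus_commute)
        then show ?thesis using p'(2) pos by (meson mult_left_mono less_imp_le order_trans)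
      qed
      moreover have "real_of_ereal (dist_map F z) = norm (y - p)" using p z by simp
      moreover have "(1 + l) * norm (z - z') = norm (z - z') + l * norm (z - z')"
        by (simp add: algebra_simps)
      ultimately show ?thesis by linarith
    qed
    have "(1 + l)-lipschitz_on U (\<lambda>z. real_of_ereal (dist_map F z))"
    proof (rule lipschitz_onI)
      fix z z' assume "z \<in> U" "z' \<in> U"
      then show "dist (real_of_ereal (dist_map F z)) (real_of_ereal (dist_map F z')) \<le> (1 + l) * dist z z'"
        using est[of z z'] est[of z' z] by (simp add: dist_norm norm_minus_commute abs_le_iff)
    qed (use pos in simp)
    moreover have "open U" unfolding U_def by (intro open_Times open_ball)
    moreover have "(x0, y0) \<in> U" using e by (simp add: U)
    ultimately show ?thesis
      using fin by (intro exI[of _ U]) (simp add: finite_lipschitz_on_def interior_open)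
  qed
  then have "dist_locally_lipschitz F R (1 + l) V" by (auto simp: dist_locally_lipschitz_def)
  moreover have "ybar \<in> interior V" using pos by (simp add: V_def interior_open)
  ultimately show ?thesis using pos by (intro exI[of _ R] exI[of _ "1 + l"] conjI exI[of _ V]) auto
qed

text \<open>The distance vanishes on the graph, so at \<open>(x', y)\<close> it is at most \<open>l * norm (x' - x)\<close>, and a
  nearest value in \<open>F x'\<close> is the one sought; finiteness is what guarantees \<open>F x' \<noteq> {}\<close>.\<close>

lemma lower_lipschitz_if_dist_locally_lipschitz:
  fixes F :: "'a::euclidean_space \<Rightarrow> 'b::euclidean_space set"
  assumes cl: "closed (gph F)" and "R > 0" "l > 0" "ybar \<in> interior V"
    and lip: "dist_locally_lipschitz F R l V"
  shows "lower_lipschitz_near_infinity F ybar"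
proof -
  obtain \<rho> where "\<rho> > 0" and \<rho>: "ball ybar \<rho> \<subseteq> V"
    using \<open>ybar \<in> interior V\<close> mem_interior by blast
  have "\<exists>\<delta>>0. \<forall>x'. norm (x' - x) < \<delta> \<longrightarrow> (\<exists>y'\<in>F x'. norm (y' - y) \<le> l * norm (x' - x))"
    if "y \<in> F x" "R < norm x" "norm (y - ybar) < \<rho>" for x y
  proof -
    have "(x, y) \<in> gph F \<inter> ((- cball 0 R) \<times> V)"
      using \<rho> that by (auto simp: subset_iff dist_norm norm_minus_commute)
    then obtain U where U: "(x, y) \<in> interior U" and fl: "finite_lipschitz_on l U (dist_map F)"
      using lip unfolding dist_locally_lipschitz_def by blast
    obtain \<delta> where "\<delta> > 0" and \<delta>: "ball (x, y) \<delta> \<subseteq> U" using U mem_interior by blast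
    have "\<exists>y'\<in>F x'. norm (y' - y) \<le> l * norm (x' - x)" if x': "norm (x' - x) < \<delta>" for x'
    proof -
      have "(x, y) \<in> U" "(x', y) \<in> U"
        using \<delta> \<open>\<delta> > 0\<close> x' by (auto simp: subset_iff dist_Pair_Pair dist_norm norm_minus_commute)
      then have fin: "\<bar>dist_map F (x', y)\<bar> \<noteq> \<infinity>" and
        "dist (real_of_ereal (dist_map F (x', y))) (real_of_ereal (dist_map F (x, y))) \<le> l * dist (x', y) (x, y)"
        using fl unfolding finite_lipschitz_on_def by (auto dest: lipschitz_onD)
      then have "\<bar>real_of_ereal (dist_map F (x', y))\<bar> \<le> l * norm (x' - x)"
        using dist_map_gph[of y F x, OF \<open>y \<in> F x\<close>]
        by (simp add: dist_Pair_Pair dist_norm del: abs_real_of_ereal)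
      then have le: "real_of_ereal (dist_map F (x', y)) \<le> l * norm (x' - x)" by linarith
      have "F x' \<noteq> {}" using fin dist_map_empty[of F x' y] by auto
      then obtain y' where "y' \<in> F x'" "dist_map F (x', y) = ereal (norm (y - y'))"
        using dist_map_nearest[of F x' y] closed_values[OF cl] by blast
      with le show ?thesis by (auto simp: norm_minus_commute)
    qed
    with \<open>\<delta> > 0\<close> show ?thesis by blast
  qed
  then show ?thesis using \<open>R > 0\<close> \<open>l > 0\<close> \<open>\<rho> > 0\<close> unfolding lower_lipschitz_near_infinity_def by blast
qed

lemma eventually_subgradient_le:
  fixes F :: "'a::euclidean_space \<Rightarrow> 'b::euclidean_space set"
  assumes lip: "dist_locally_lipschitz F R l V" and V: "ybar \<in> interior V"
    and s: "\<And>k. (xs k, ys k) \<in> gph F" "filterlim (\<lambda>k. norm (xs k)) at_top sequentially" "ys \<longlonglongrightarrow> ybar"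
    and ws: "\<And>k. ws k \<in> limiting_subdifferential (dist_map F) (xs k, ys k)"
  shows "\<forall>\<^sub>F k in sequentially. norm (ws k) \<le> l"
proof -
  obtain \<rho> where "\<rho> > 0" and \<rho>: "ball ybar \<rho> \<subseteq> V" using V mem_interior by blast
  show ?thesis
    using eventually_near_infinity[OF s(2,3) \<open>\<rho> > 0\<close>, of R]
  proof eventually_elim
    case (elim k)
    then have "(xs k, ys k) \<in> gph F \<inter> ((- cball 0 R) \<times> V)"
      using \<rho> s(1) by (auto simp: subset_iff dist_norm norm_minus_commute)
    then obtain U where "(xs k, ys k) \<in> interior U" "finite_lipschitz_on l U (dist_map F)"
      using lip unfolding dist_locally_lipschitz_def by blast
    then show ?case using subgradient_norm_le_lipschitz ws by blast
  qed
qed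

lemma dist_subgradients_at_infinity_bounded:
  fixes F :: "'a::euclidean_space \<Rightarrow> 'b::euclidean_space set"
  assumes "dist_locally_lipschitz F R l V" "ybar \<in> interior V"
    and "w \<in> dist_subgradients_at_infinity F ybar"
  shows "norm w \<le> l"
proof -
  obtain xs ys ws where s: "\<And>k. (xs k, ys k) \<in> gph F" "filterlim (\<lambda>k. norm (xs k)) at_top sequentially"
      "ys \<longlonglongrightarrow> ybar" "\<And>k. ws k \<in> limiting_subdifferential (dist_map F) (xs k, ys k)" and w: "ws \<longlonglongrightarrow> w"
    using assms(3) unfolding dist_subgradients_at_infinity_def by auto
  show ?thesis
    using Lim_norm_ubound[OF sequentially_bot w eventually_subgradient_le[OF assms(1,2) s]] by simp
qed

lemma horizon_subgradients_trivial:
  fixes F :: "'a::euclidean_space \<Rightarrow> 'b::euclidean_space set"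
  assumes lip: "dist_locally_lipschitz F R l V" "ybar \<in> interior V"
    and cl: "closed (gph F)" and jel: "ybar \<in> jelonek_set F"
  shows "dist_horizon_subgradients_at_infinity F ybar = {0}"
proof -
  have "w = 0" if w: "w \<in> dist_horizon_subgradients_at_infinity F ybar" for w
  proof -
    obtain xs ys ws rs where s: "\<And>k. (xs k, ys k) \<in> gph F" "filterlim (\<lambda>k. norm (xs k)) at_top sequentially"
        "ys \<longlonglongrightarrow> ybar" "\<And>k. ws k \<in> limiting_subdifferential (dist_map F) (xs k, ys k)"
      and r: "rs \<longlonglongrightarrow> (0::real)" and w: "(\<lambda>k. rs k *\<^sub>R ws k) \<longlonglongrightarrow> w"
      using w unfolding dist_horizon_subgradients_at_infinity_def by auto
    have "\<forall>\<^sub>F k in sequentially. norm (rs k *\<^sub>R ws k) \<le> \<bar>rs k\<bar> * l"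
      using eventually_subgradient_le[OF lip s]
      by eventually_elim (simp add: mult_left_mono)
    moreover have "(\<lambda>k. \<bar>rs k\<bar> * l) \<longlonglongrightarrow> 0"
      using tendsto_mult_right[OF tendsto_rabs[OF r], of l] by simp
    ultimately have "(\<lambda>k. rs k *\<^sub>R ws k) \<longlonglongrightarrow> 0" by (rule Lim_null_comparison)
    then show "w = 0" using w LIMSEQ_unique by blast
  qed
  moreover have "0 \<in> dist_horizon_subgradients_at_infinity F ybar"
  proof -
    obtain xs ys where s: "\<And>k. (xs k, ys k) \<in> gph F" "filterlim (\<lambda>k. norm (xs k)) at_top sequentially"
        "ys \<longlonglongrightarrow> ybar"
      using jel unfolding jelonek_set_def by auto
    have "0 \<in> limiting_subdifferential (dist_map F) (xs k, ys k)" for k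
      using regular_normal_subgradient_dist_map[OF cl, of "ys k" "xs k" 0 0] s(1)[of k]
        zero_in_regular_normal_cone[of "gph F"] by (simp add: zero_prod_def)
    then show ?thesis
      unfolding dist_horizon_subgradients_at_infinity_def mem_Collect_eq
      using s LIMSEQ_inverse_real_of_nat
      by (intro exI[of _ xs] exI[of _ ys] exI[of _ "\<lambda>k. inverse (real (Suc k))"] exI[of _ "\<lambda>_. 0"]) auto
  qed
  ultimately show ?thesis by blast
qed

text \<open>For a normal limit \<open>(u, 0)\<close> the second components tend to \<open>0\<close>.  This leaves room for dividing the
  normals by scales that also tend to \<open>0\<close> while keeping the second components below 1, as is needed
  to recognise them as subgradients of the distance function.\<close>

lemma coderivative_trivial_if_horizon_trivial:
  fixes F :: "'a::euclidean_space \<Rightarrow> 'b::euclidean_space set"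
  assumes cl: "closed (gph F)" and jel: "ybar \<in> jelonek_set F"
    and hor: "dist_horizon_subgradients_at_infinity F ybar = {0}"
  shows "coderivative_at_infinity F ybar 0 = {0}"
proof -
  have "u = 0" if u: "u \<in> coderivative_at_infinity F ybar 0" for u
  proof -
    obtain xs ys \<xi>s where s: "\<And>k. (xs k, ys k) \<in> gph F"
      "filterlim (\<lambda>k. norm (xs k)) at_top sequentially" "ys \<longlonglongrightarrow> ybar"
      and \<xi>: "\<And>k. \<xi>s k \<in> regular_normal_cone (gph F) (xs k, ys k)" and \<xi>lim: "\<xi>s \<longlonglongrightarrow> (u, 0)"
      using u unfolding coderivative_at_infinity_def normal_cone_at_infinity_def by auto
    \<comment> \<open>The summand \<open>inverse (real (Suc k))\<close> keeps \<open>rs k\<close> positive where the second component vanishes.\<close>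
    define rs where "rs k = 2 * norm (snd (\<xi>s k)) + inverse (real (Suc k))" for k
    have rpos: "rs k > 0" for k by (auto simp: rs_def intro: add_nonneg_pos)
    have "rs \<longlonglongrightarrow> 2 * norm (0::'b) + 0"
      unfolding rs_def using tendsto_snd[OF \<xi>lim]
      by (intro tendsto_intros LIMSEQ_inverse_real_of_nat) simp
    then have rlim: "rs \<longlonglongrightarrow> 0" by simp
    have sub: "inverse (rs k) *\<^sub>R \<xi>s k \<in> limiting_subdifferential (dist_map F) (xs k, ys k)" for k
    proof -
      have "norm (snd (\<xi>s k)) < rs k"
        unfolding rs_def by (simp add: add_nonneg_pos)
      then have "norm (inverse (rs k) *\<^sub>R snd (\<xi>s k)) < 1"
        using rpos[of k] by (simp add: field_simps)
      moreover have "(inverse (rs k) *\<^sub>R fst (\<xi>s k), inverse (rs k) *\<^sub>R snd (\<xi>s k))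
          \<in> regular_normal_cone (gph F) (xs k, ys k)"
        using regular_normal_cone_scaleR[OF \<xi>[of k], of "inverse (rs k)"] rpos[of k]
        by (simp add: scaleR_prod_def)
      ultimately show ?thesis
        using regular_normal_subgradient_dist_map[OF cl] s(1)[of k]
        by (simp add: scaleR_prod_def)
    qed
    have "(\<lambda>k. rs k *\<^sub>R inverse (rs k) *\<^sub>R \<xi>s k) \<longlonglongrightarrow> (u, 0)"
      using \<xi>lim rpos by (simp add: less_imp_neq[symmetric])
    then have "(u, 0) \<in> dist_horizon_subgradients_at_infinity F ybar"
      unfolding dist_horizon_subgradients_at_infinity_def mem_Collect_eq
      using s rpos rlim sub
      by (intro exI[of _ xs] exI[of _ ys] exI[of _ rs] exI[of _ "\<lambda>k. inverse (rs k) *\<^sub>R \<xi>s k"]) auto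
    then show "u = 0" using hor by (simp add: zero_prod_def)
  qed
  then show ?thesis using zero_in_coderivative_at_infinity[OF jel] by blast
qed

theorem theorem4p5:
  fixes F :: "real ^ 'n \<Rightarrow> (real ^ 'm) set"
    and ybar :: "real ^ 'm"
  assumes "closed (gph F)"
    and "ybar \<in> jelonek_set F"
  shows
    "(coderivative_at_infinity F ybar 0 = {0} \<longleftrightarrow>
       (\<exists>R>0. \<exists>l>0. \<exists>V. open V \<and> ybar \<in> V \<and> open (inv_map F V - cball 0 R) \<and>
          (\<forall>x \<in> inv_map F V - cball 0 R. \<forall>x' \<in> inv_map F V - cball 0 R.
             F x \<inter> V \<subseteq> F x' + (*\<^sub>R) (l * norm (x - x')) ` cball 0 1)))
     \<and> (coderivative_at_infinity F ybar 0 = {0} \<longleftrightarrow>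
       (\<exists>R>0. \<exists>l>0. \<exists>V. ybar \<in> interior V \<and> dist_locally_lipschitz F R l V))
     \<and> (coderivative_at_infinity F ybar 0 = {0} \<longleftrightarrow>
       dist_horizon_subgradients_at_infinity F ybar = {0})
     \<and> (coderivative_at_infinity F ybar 0 = {0} \<longrightarrow>
       (\<forall>R>0. \<forall>l>0. \<forall>V. ybar \<in> interior V \<and> dist_locally_lipschitz F R l V \<longrightarrow>
          (\<forall>u \<in> dist_subgradients_at_infinity F ybar. norm u \<le> l)))"
  (is "(?i \<longleftrightarrow> ?ii) \<and> (?i \<longleftrightarrow> ?iii) \<and> (?i \<longleftrightarrow> ?iv) \<and> (?i \<longrightarrow> ?bound)")
proof -
  have "?i \<Longrightarrow> ?ii" by (rule lipschitz_like_if_coderivative_trivial[OF assms(1)])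
  moreover have "?i" if ii: ?ii
  proof -
    obtain R l V where "R > 0" "l > 0" "open V" "ybar \<in> V" "open (inv_map F V - cball 0 R)"
      and lip: "\<forall>x \<in> inv_map F V - cball 0 R. \<forall>x' \<in> inv_map F V - cball 0 R.
             F x \<inter> V \<subseteq> F x' + (*\<^sub>R) (l * norm (x - x')) ` cball 0 1"
      using ii by (elim exE conjE) (rule that)
    then have "lower_lipschitz_near_infinity F ybar"
      using lower_lipschitz_if_lipschitz_like[OF _ _ _ _ _ lip[rule_format]] by metis
    then show ?i by (rule coderivative_trivial_if_lower_lipschitz[OF assms(2)])
  qed
  moreover have "?i \<Longrightarrow> ?iii" by (rule dist_locally_lipschitz_if_coderivative_trivial[OF assms(1)])
  moreover have "?i \<and> ?iv" if iii: ?iii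
  proof -
    obtain R l V where RlV: "R > 0" "l > 0" "ybar \<in> interior V" "dist_locally_lipschitz F R l V"
      using iii by (elim exE conjE) (rule that)
    have ?i
      by (rule coderivative_trivial_if_lower_lipschitz[OF assms(2)
            lower_lipschitz_if_dist_locally_lipschitz[OF assms(1) RlV]])
    moreover have ?iv by (rule horizon_subgradients_trivial[OF RlV(4,3) assms])
    ultimately show ?thesis ..
  qed
  moreover have "?iv \<Longrightarrow> ?i" by (rule coderivative_trivial_if_horizon_trivial[OF assms])
  moreover have ?bound
    by (intro allI impI ballI) (elim conjE, rule dist_subgradients_at_infinity_bounded)
  ultimately show ?thesis by argo
qed

end
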